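(* Let $N\in[M]$ and $p\in(0,1]$, set $\omega_{\mathrm{av}}=\frac{M-N}{N(M-1)}$ and choose a real $b>1$. Set $a=\max\Big(1-(1+b)\frac{M-N}{N(M-1)},0\Big)$. Consider the iterates $(x^k)_{k\ge 0}$ and $(y^k)_{k\ge0}$ generated by the algorithm Minibatch-L-SVRG (defined in the context) with sampling size $N$, probability $p$ and stepsize $\gamma$ such that $$0<\gamma\le\frac1L\,\frac1{a+(1+b)^2\omega_{\mathrm{av}}},$$ and let $h_m^k=\nabla F_m(y^k)$ for $m\in[M]$, $k\ge0$. For every $k\ge 0$ define $$\Psi^k=\|x^k-x^\star\|^2+(b^2+b)\gamma^2\omega_{\mathrm{av}}\frac1{pM}\sum_{m=1}^M\|h_m^k-h_m^\star\|^2 .$$ Then, for every $k\ge0$, $\mathbb E[\Psi^k]\le c^k\Psi^0$, where $$c=1-\min\left\{\gamma\mu,\ p(1-b^{-2})\right\}.$$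
   Context: Convention: $\frac{M-N}{N(M-1)}$ is read as $0$ when $M=N=1$. Problem. Let $d\ge1$, $M\ge1$, $[M]=\{1,\dots,M\}$. Let $F_1,\dots,F_M:\mathbb R^d\to\mathbb R$ be convex, differentiable and $L$-smooth for some $L>0$ (i.e. $\nabla F_m$ is $L$-Lipschitz), let $F=\frac1M\sum_{m=1}^M F_m$ be $\mu$-strongly convex for some $\mu>0$ (i.e. $F-\frac\mu2\|\cdot\|^2$ is convex), and let $R:\mathbb R^d\to\mathbb R\cup\{+\infty\}$ be proper, closed, convex. Let $x^\star$ be the unique minimizer of $R+F$ and $h_m^\star=\nabla F_m(x^\star)$. For $\gamma>0$, $\mathrm{prox}_{\gamma R}(w)=\arg\min_{x}\big(\gamma R(x)+\frac12\|x-w\|^2\big)$. Norms are Euclidean. Algorithm Minibatch-L-SVRG. Input: $\gamma>0$, sampling size $N\in[M]$, probability $p\in(0,1]$, deterministic $x^0\in\mathbb R^d$; $h^0=\frac1M\sum_{m=1}^M\nabla F_m(x^0)$, $y^0=x^0$. For $k=0,1,\dots$: pick $\Omega^k\subset[M]$ of size $N$ uniformly at random; set $d^{k+1}=\frac1N\sum_{m\in\Omega^k}\big(\nabla F_m(x^k)-\nabla F_m(y^k)\big)$, $x^{k+1}=\mathrm{prox}_{\gamma R}\big(x^k-\gamma(h^k+d^{k+1})\big)$; pick randomly $s^k=1$ with probability $p$ and $s^k=0$ with probability $1-p$; if $s^k=1$, set $h^{k+1}=\frac1M\sum_{m=1}^M\nabla F_m(x^k)$ and $y^{k+1}=x^k$;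 otherwise set $h^{k+1}=h^k$ and $y^{k+1}=y^k$. The random pairs $(\Omega^k,s^k)$ are independent over $k$. *)

theory Defs
  imports "HOL-Probability.Probability"
begin

definition grad :: "('a::real_inner \<Rightarrow> real) \<Rightarrow> 'a \<Rightarrow> 'a" where
  "grad f x = (THE g. GDERIV f x :> g)"

definition L_smooth :: "real \<Rightarrow> ('a::real_inner \<Rightarrow> real) \<Rightarrow> bool" where
  "L_smooth L f \<longleftrightarrow> (\<forall>x. f differentiable (at x)) \<and> L-lipschitz_on UNIV (grad f)"

definition strongly_convex :: "real \<Rightarrow> ('a::real_inner \<Rightarrow> real) \<Rightarrow> bool" where
  "strongly_convex \<mu> f \<longleftrightarrow> convex_on UNIV (\<lambda>x. f x - \<mu> / 2 * (norm x)\<^sup>2)"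

definition ereal_epigraph :: "('a \<Rightarrow> ereal) \<Rightarrow> ('a \<times> real) set" where
  "ereal_epigraph f = {(x, t). f x \<le> ereal t}"

text \<open>Closedness and convexity of an extended-real function are those of its epigraph;
  the value minus infinity is excluded by properness.\<close>

definition proper_closed_convex :: "('a::real_normed_vector \<Rightarrow> ereal) \<Rightarrow> bool" where
  "proper_closed_convex f \<longleftrightarrow>
     (\<forall>x. f x \<noteq> -\<infinity>) \<and> (\<exists>x. f x \<noteq> \<infinity>) \<and>
     closed (ereal_epigraph f) \<and> convex (ereal_epigraph f)"

definition prox :: "real \<Rightarrow> ('a::real_normed_vector \<Rightarrow> ereal) \<Rightarrow> 'a \<Rightarrow> 'a" where
  "prox \<gamma> R w = arg_min (\<lambda>x. ereal \<gamma> * R x + ereal (1 / 2 * (norm (x - w))\<^sup>2)) (\<lambda>_. True)"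

definition average :: "nat \<Rightarrow> (nat \<Rightarrow> 'a::real_vector) \<Rightarrow> 'a" where
  "average M v = (1 / real M) *\<^sub>R (\<Sum>m=1..M. v m)"

definition size_subsets :: "nat \<Rightarrow> nat \<Rightarrow> nat set set" where
  "size_subsets M N = {A. A \<subseteq> {1..M} \<and> card A = N}"

text \<open>The state of the algorithm after \<open>k\<close> iterations is the triple \<open>(x, h, y)\<close>;
  \<open>Om\<close> and \<open>s\<close> are one realization of the random samples and coin flips.\<close>

primrec minibatch_lsvrg ::
  "(nat \<Rightarrow> 'a::real_inner \<Rightarrow> real) \<Rightarrow> nat \<Rightarrow> ('a \<Rightarrow> ereal) \<Rightarrow> real \<Rightarrow> nat \<Rightarrow> 'a \<Rightarrow>
   (nat \<Rightarrow> nat set) \<Rightarrow> (nat \<Rightarrow> bool) \<Rightarrow> nat \<Rightarrow> 'a \<times> 'a \<times> 'a" where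
  "minibatch_lsvrg F M R \<gamma> N x0 Om s 0 = (x0, average M (\<lambda>m. grad (F m) x0), x0)"
| "minibatch_lsvrg F M R \<gamma> N x0 Om s (Suc k) =
     (let (x, h, y) = minibatch_lsvrg F M R \<gamma> N x0 Om s k;
          d = (1 / real N) *\<^sub>R (\<Sum>m\<in>Om k. grad (F m) x - grad (F m) y);
          x' = prox \<gamma> R (x - \<gamma> *\<^sub>R (h + d))
      in (x', if s k then average M (\<lambda>m. grad (F m) x) else h, if s k then x else y))"

text \<open>The law of the random choices: the pairs \<open>(Om k, s k)\<close> are independent over \<open>k\<close>,
  with the prescribed marginals. Nothing is required about the joint law within one pair.\<close>

definition lsvrg_sampling ::
  "'w measure \<Rightarrow> nat \<Rightarrow> nat \<Rightarrow> real \<Rightarrow> (nat \<Rightarrow> 'w \<Rightarrow> nat set) \<Rightarrow> (nat \<Rightarrow> 'w \<Rightarrow> bool) \<Rightarrow> bool" where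
  "lsvrg_sampling P M N p Om s \<longleftrightarrow>
     prob_space P \<and>
     prob_space.indep_vars P (\<lambda>_. count_space (size_subsets M N \<times> UNIV))
       (\<lambda>k w. (Om k w, s k w)) UNIV \<and>
     (\<forall>k. distr P (count_space (size_subsets M N)) (Om k)
            = uniform_count_measure (size_subsets M N)) \<and>
     (\<forall>k. distr P (count_space UNIV) (s k) = measure_pmf (bernoulli_pmf p))"

end

theory Submission
  imports Defs
begin

text \<open>Firm nonexpansiveness of the proximal map, in variational form, reduces the step to the gradient
  estimate \<open>g = h + d\<close>: its mean is \<open>\<nabla>F(x)\<close>, and its variance is the variance of a sample mean without
  replacement, \<open>\<omega>av\<close> times the variance of \<open>\<nabla>F\<^sub>m(x) - \<nabla>F\<^sub>m(y)\<close> over \<open>m\<close>. Young's inequality with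
  weight \<open>b\<close>, applied to that variance, separates \<open>x\<close> from \<open>y\<close>. The part in \<open>x\<close> is absorbed by
  twice \<open>\<langle>x - x\<^sup>*, \<nabla>F(x) - \<nabla>F(x\<^sup>*)\<rangle>\<close>, once through cocoercivity of each \<open>\<nabla>F\<^sub>m\<close> and once through strong
  monotonicity of \<open>\<nabla>F\<close>; the part in \<open>y\<close> is what the second term of \<open>\<Psi>\<close> can lose.\<close>

section \<open>Gradients of convex and smooth functions\<close>

lemma DERIV_along_line:
  assumes "GDERIV f (x + t *\<^sub>R d) :> g"
  shows "((\<lambda>t. f (x + t *\<^sub>R d)) has_real_derivative d \<bullet> g) (at t)"
proof -
  have 1: "((\<lambda>t. x + t *\<^sub>R d) has_derivative (\<lambda>s. s *\<^sub>R d)) (at t)"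
    by (auto intro!: derivative_eq_intros)
  have "((\<lambda>t. f (x + t *\<^sub>R d)) has_derivative (\<lambda>s. (s *\<^sub>R d) \<bullet> g)) (at t)"
    using diff_chain_at[OF 1 assms[unfolded gderiv_def]] by (simp add: o_def)
  then show ?thesis
    by (simp add: has_field_derivative_def mult_commute_abs)
qed

text \<open>Convexity controls difference quotients along a segment, hence only those with
  \<open>t\<close> in \<open>(0, 1]\<close>; their limit from the right is
  \<open>d \<bullet> g\<close>. Both the tangent inequality and the optimality condition at a
  minimizer are instances.\<close>

lemma GDERIV_inner_ge:
  assumes D: "GDERIV f x :> g"
    and K: "\<And>t. 0 < t \<Longrightarrow> t \<le> 1 \<Longrightarrow> t * K \<le> f (x + t *\<^sub>R d) - f x"
  shows "K \<le> d \<bullet> g"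
proof -
  have "((\<lambda>t. f (x + t *\<^sub>R d)) has_real_derivative d \<bullet> g) (at 0)"
    by (rule DERIV_along_line) (simp add: D)
  then have "((\<lambda>t. (f (x + t *\<^sub>R d) - f x) / t) \<longlongrightarrow> d \<bullet> g) (at_right 0)"
    unfolding has_field_derivative_iff by (auto intro: filterlim_at_withinI filterlim_mono[OF _ order_refl] simp: at_le)
  moreover have "\<forall>\<^sub>F t in at_right 0. K \<le> (f (x + t *\<^sub>R d) - f x) / t"
    using eventually_at_right_real[OF zero_less_one]
    by eventually_elim (use K in \<open>auto simp: field_simps\<close>)
  ultimately show ?thesis
    by (rule tendsto_lowerbound) simp
qed

lemma GDERIV_unique:
  assumes "GDERIV f x :> g" and "GDERIV f x :> g'"
  shows "g = g'"
proof -
  have "(\<lambda>h. h \<bullet> g) = (\<lambda>h. h \<bullet> g')"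
    using assms has_derivative_unique unfolding gderiv_def by blast
  then show ?thesis
    by (metis inner_commute vector_eq_rdot)
qed

text \<open>The coordinates of the derivative in the orthonormal basis supply a gradient, and
  uniqueness gives the \<open>THE\<close> in \<open>grad\<close> its value.\<close>

lemma GDERIV_grad:
  fixes f :: "'a::euclidean_space \<Rightarrow> real"
  assumes "f differentiable (at x)"
  shows "GDERIV f x :> grad f x"
proof -
  obtain f' where f': "(f has_derivative f') (at x)"
    using assms by (auto simp: differentiable_def)
  then interpret bounded_linear f' by (rule has_derivative_bounded_linear)
  have "f' h = h \<bullet> (\<Sum>i\<in>Basis. f' i *\<^sub>R i)" for h
  proof -
    have "f' h = f' (\<Sum>i\<in>Basis. (h \<bullet> i) *\<^sub>R i)"
      by (simp add: euclidean_representation)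
    also have "\<dots> = h \<bullet> (\<Sum>i\<in>Basis. f' i *\<^sub>R i)"
      by (simp add: sum scaleR inner_sum_right mult.commute)
    finally show ?thesis .
  qed
  then have "f' = (\<lambda>h. h \<bullet> (\<Sum>i\<in>Basis. f' i *\<^sub>R i))" by blast
  then have "GDERIV f x :> (\<Sum>i\<in>Basis. f' i *\<^sub>R i)"
    using f' by (simp add: gderiv_def)
  then show ?thesis
    unfolding grad_def by (rule theI) (use GDERIV_unique \<open>GDERIV f x :> _\<close> in blast)
qed

lemma convex_on_above_tangent:
  assumes f: "convex_on UNIV f" and D: "GDERIV f x :> g"
  shows "f z \<ge> f x + (z - x) \<bullet> g"
proof -
  \<comment> \<open>\<open>GDERIV_inner_ge\<close> bounds the inner product from below, whereas
    convexity bounds the quotients of \<open>f\<close> from above; hence the passage to the negative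
    of \<open>f\<close>.\<close>
  have "- (f z - f x) \<le> (z - x) \<bullet> (- g)"
  proof (rule GDERIV_inner_ge[OF GDERIV_minus[OF D]])
    fix t :: real assume t: "0 < t" "t \<le> 1"
    have "f ((1 - t) *\<^sub>R x + t *\<^sub>R z) \<le> (1 - t) * f x + t * f z"
      using convex_onD[OF f, of t x z] t by auto
    moreover have "(1 - t) *\<^sub>R x + t *\<^sub>R z = x + t *\<^sub>R (z - x)"
      by (simp add: algebra_simps)
    ultimately show "t * - (f z - f x) \<le> - f (x + t *\<^sub>R (z - x)) - - f x"
      by (simp add: algebra_simps)
  qed
  then show ?thesis by simp
qed

lemma L_smooth_descent:
  fixes f :: "'a::euclidean_space \<Rightarrow> real"
  assumes f: "L_smooth L f"
  shows "f z \<le> f w + (z - w) \<bullet> grad f w + L / 2 * (norm (z - w))\<^sup>2"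
proof -
  define d where "d = z - w"
  \<comment> \<open>\<open>\<phi>\<close> is the gap between \<open>f\<close> and its quadratic
    model at \<open>w\<close> along the segment. The claim is
    \<open>\<phi> 1 \<le> \<phi> 0\<close>, and the derivative is nonpositive by Cauchy-Schwarz and
    the Lipschitz bound.\<close>
  define \<phi> where "\<phi> t = f (w + t *\<^sub>R d) - t * (d \<bullet> grad f w) - L / 2 * t\<^sup>2 * (norm d)\<^sup>2" for t
  have D: "GDERIV f v :> grad f v" for v
    using f by (intro GDERIV_grad) (simp add: L_smooth_def)
  have "\<phi> 1 \<le> \<phi> 0"
  proof (rule DERIV_nonpos_imp_nonincreasing[where f = \<phi>])
    fix t :: real assume t: "0 \<le> t"
    let ?g = "grad f (w + t *\<^sub>R d) - grad f w"
    have "(\<phi> has_real_derivative d \<bullet> grad f (w + t *\<^sub>R d) - d \<bullet> grad f w - L * t * (norm d)\<^sup>2) (at t)"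
      unfolding \<phi>_def by (auto intro!: derivative_eq_intros DERIV_along_line D)
    moreover have "d \<bullet> ?g \<le> norm d * norm ?g"
      by (rule norm_cauchy_schwarz)
    moreover have "norm ?g \<le> L * (t * norm d)"
      using f t lipschitz_onD[of L UNIV "grad f" "w + t *\<^sub>R d" w]
      by (simp add: L_smooth_def dist_norm)
    then have "norm d * norm ?g \<le> norm d * (L * (t * norm d))"
      by (rule mult_left_mono) simp
    ultimately show "\<exists>D. (\<phi> has_real_derivative D) (at t) \<and> D \<le> 0"
      by - (rule exI[of _ "d \<bullet> grad f (w + t *\<^sub>R d) - d \<bullet> grad f w - L * t * (norm d)\<^sup>2"], simp_all add: inner_diff_right power2_eq_square mult_ac)
  qed simp
  then show ?thesis by (simp add: \<phi>_def d_def)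
qed

lemma convex_smooth_bregman_ge:
  fixes f :: "'a::euclidean_space \<Rightarrow> real"
  assumes cf: "convex_on UNIV f" and f: "L_smooth L f" and L: "L > 0"
  shows "f w \<ge> f x + (w - x) \<bullet> grad f x + 1 / (2 * L) * (norm (grad f w - grad f x))\<^sup>2"
proof -
  have D: "GDERIV f v :> grad f v" for v
    using f by (intro GDERIV_grad) (simp add: L_smooth_def)
  define e where "e = grad f w - grad f x"
  \<comment> \<open>\<open>z\<close> minimizes the quadratic upper model of \<open>f\<close> at
    \<open>w\<close> minus the linear term of slope \<open>grad f x\<close>. Bounding
    \<open>f z\<close> below by the tangent at \<open>x\<close> and above by that model leaves
    \<open>1 / (2 * L) * (norm e)\<^sup>2\<close>.\<close>
  define z where "z = w - (1 / L) *\<^sub>R e"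
  have "f z \<ge> f x + (z - x) \<bullet> grad f x"
    using cf D by (rule convex_on_above_tangent)
  moreover have "f z \<le> f w + (z - w) \<bullet> grad f w + L / 2 * (norm (z - w))\<^sup>2"
    using f by (rule L_smooth_descent)
  moreover have "L / 2 * (norm (z - w))\<^sup>2 = 1 / (2 * L) * (norm e)\<^sup>2"
    using L by (simp add: z_def power_mult_distrib power2_eq_square)
  moreover have "(z - x) \<bullet> grad f x - (z - w) \<bullet> grad f w = (w - x) \<bullet> grad f x + 1 / L * (norm e)\<^sup>2"
    by (simp add: z_def e_def algebra_simps power2_norm_eq_inner inner_diff)
  moreover have "1 / L * (norm e)\<^sup>2 = 2 * (1 / (2 * L) * (norm e)\<^sup>2)" by simp
  ultimately have "f w \<ge> f x + (w - x) \<bullet> grad f x + 1 / (2 * L) * (norm e)\<^sup>2" by linarith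
  then show ?thesis by (simp add: e_def)
qed

text \<open>The bound \<open>convex_smooth_bregman_ge\<close> in both orders, added: the function
  values cancel and the constant doubles.\<close>

lemma cocoercive:
  fixes f :: "'a::euclidean_space \<Rightarrow> real"
  assumes "convex_on UNIV f" and "L_smooth L f" and "L > 0"
  shows "(w - x) \<bullet> (grad f w - grad f x) \<ge> 1 / L * (norm (grad f w - grad f x))\<^sup>2"
proof -
  have "1 / L * (norm (grad f w - grad f x))\<^sup>2 = 2 * (1 / (2 * L) * (norm (grad f w - grad f x))\<^sup>2)"
    by simp
  then show ?thesis
    using convex_smooth_bregman_ge[OF assms, where w=w and x=x] convex_smooth_bregman_ge[OF assms, where w=x and x=w]
    by (simp add: norm_minus_commute inner_diff_left inner_diff_right)
qed

lemma GDERIV_norm_squared: "GDERIV (\<lambda>x. (norm (x - w))\<^sup>2) x :> 2 *\<^sub>R (x - w)"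
  unfolding gderiv_def power2_norm_eq_inner
  by (auto intro!: derivative_eq_intros simp: inner_commute algebra_simps)

text \<open>The tangent inequalities of the convex part at \<open>x\<close> and at \<open>w\<close>
  are added. \<open>g\<close> is any gradient field, so that for an average of functions it can be
  the average of their gradients.\<close>

lemma strongly_convex_monotone:
  assumes f: "strongly_convex \<mu> f" and D: "\<And>z. GDERIV f z :> g z"
  shows "(w - x) \<bullet> (g w - g x) \<ge> \<mu> * (norm (w - x))\<^sup>2"
proof -
  let ?q = "\<lambda>z. f z - \<mu> / 2 * (norm z)\<^sup>2"
  have "GDERIV (\<lambda>z. (norm z)\<^sup>2) z :> 2 *\<^sub>R z" for z :: 'a
    using GDERIV_norm_squared[of 0] by simp
  then have "GDERIV (\<lambda>z. \<mu> / 2 * (norm z)\<^sup>2) z :> \<mu> *\<^sub>R z" for z :: 'a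
    using GDERIV_mult[OF GDERIV_const[of "\<mu> / 2"]] by fastforce
  then have D': "GDERIV ?q z :> g z - \<mu> *\<^sub>R z" for z
    by (intro GDERIV_diff D)
  have "convex_on UNIV ?q" using f by (simp add: strongly_convex_def)
  note this[THEN convex_on_above_tangent, OF D']
  from this[of x w] this[of w x] show ?thesis
    by (simp add: power2_norm_eq_inner inner_diff_left inner_diff_right inner_commute algebra_simps)
qed

lemma GDERIV_average:
  assumes "\<And>m. m \<in> {1..M} \<Longrightarrow> GDERIV (F m) z :> g m"
  shows "GDERIV (\<lambda>z. average M (\<lambda>m. F m z)) z :> average M g"
  using assms unfolding gderiv_def average_def
  by (auto intro!: derivative_eq_intros simp: inner_sum_right sum_distrib_left)

section \<open>The proximal map\<close>

lemma proper_closed_convex_finite: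
  assumes "proper_closed_convex R"
  obtains z r where "R z = ereal r"
  using assms unfolding proper_closed_convex_def by (metis ereal_cases)

text \<open>Comparison with a point of the domain of \<open>R\<close> excludes
  \<open>\<infinity>\<close>, and properness excludes \<open>-\<infinity>\<close>. Values of
  \<open>R\<close> at minimizers can then be subtracted as reals.\<close>

lemma arg_min_finite:
  fixes R :: "'a::real_normed_vector \<Rightarrow> ereal" and f :: "'a \<Rightarrow> real"
  assumes R: "proper_closed_convex R"
    and min: "is_arg_min (\<lambda>z. R z + ereal (f z)) (\<lambda>_. True) x"
  shows "\<exists>r. R x = ereal r"
proof -
  obtain z r where "R z = ereal r" using R by (rule proper_closed_convex_finite)
  moreover have "R x + ereal (f x) \<le> R z + ereal (f z)"
    using min by (auto simp: is_arg_min_def not_less)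
  moreover have "R x \<noteq> -\<infinity>" using R by (simp add: proper_closed_convex_def)
  ultimately show ?thesis by (cases "R x") auto
qed

text \<open>Fermat's rule: the negative of \<open>g\<close> is a subgradient of \<open>R\<close> at
  \<open>x\<close>. Towards \<open>z\<close>, minimality makes \<open>f\<close> grow at least as
  much as \<open>R\<close> decreases, and convexity bounds that decrease below by
  \<open>t * (r - s)\<close>.\<close>

lemma arg_min_variational:
  fixes R :: "'a::euclidean_space \<Rightarrow> ereal" and f :: "'a \<Rightarrow> real"
  assumes R: "proper_closed_convex R"
    and min: "is_arg_min (\<lambda>z. R z + ereal (f z)) (\<lambda>_. True) x"
    and D: "GDERIV f x :> g"
    and Rx: "R x = ereal r" and Rz: "R z = ereal s"
  shows "r - s \<le> (z - x) \<bullet> g"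
proof (rule GDERIV_inner_ge[OF D])
  fix t :: real assume t: "0 < t" "t \<le> 1"
  let ?v = "x + t *\<^sub>R (z - x)"
  \<comment> \<open>Convexity of \<open>R\<close> is given as convexity of its epigraph, so the
    chord joins two points of the graph.\<close>
  have "(1 - t) *\<^sub>R (x, r) + t *\<^sub>R (z, s) \<in> ereal_epigraph R"
    using R t Rx Rz unfolding proper_closed_convex_def
    by (intro convexD) (auto simp: ereal_epigraph_def)
  moreover have "(1 - t) *\<^sub>R (x, r) + t *\<^sub>R (z, s) = (?v, (1 - t) * r + t * s)"
    by (simp add: algebra_simps)
  ultimately have "R ?v \<le> ereal ((1 - t) * r + t * s)"
    by (simp add: ereal_epigraph_def)
  then have "R ?v + ereal (f ?v) \<le> ereal ((1 - t) * r + t * s) + ereal (f ?v)"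
    by (rule add_right_mono)
  moreover have "R x + ereal (f x) \<le> R ?v + ereal (f ?v)"
    using min by (auto simp: is_arg_min_def not_less)
  ultimately have "R x + ereal (f x) \<le> ereal ((1 - t) * r + t * s) + ereal (f ?v)"
    by (rule order_trans[rotated])
  then show "t * (r - s) \<le> f ?v - f x"
    using Rx by (simp add: algebra_simps)
qed

text \<open>The new epigraph is the image of the old one under an injective linear map, which
  preserves closedness and convexity. The facts on minimizers of \<open>R\<close> plus a real
  function thereby apply to the objective of \<open>prox\<close>.\<close>

lemma proper_closed_convex_scale:
  fixes R :: "'a::euclidean_space \<Rightarrow> ereal"
  assumes R: "proper_closed_convex R" and \<gamma>: "\<gamma> > 0"
  shows "proper_closed_convex (\<lambda>z. ereal \<gamma> * R z)"
proof -
  have eq: "ereal \<gamma> * R z \<le> ereal t \<longleftrightarrow> R z \<le> ereal (t / \<gamma>)" for z t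
    using \<gamma> by (cases "R z") (auto simp: field_simps)
  have "ereal_epigraph (\<lambda>z. ereal \<gamma> * R z) = (\<lambda>(z, t). (z, \<gamma> * t)) ` ereal_epigraph R"
    (is "_ = ?T ` _")
  proof (intro set_eqI iffI)
    fix u assume "u \<in> ereal_epigraph (\<lambda>z. ereal \<gamma> * R z)"
    then have "(fst u, snd u / \<gamma>) \<in> ereal_epigraph R"
      by (auto simp: ereal_epigraph_def eq)
    moreover have "u = ?T (fst u, snd u / \<gamma>)" using \<gamma> by (cases u) simp
    ultimately show "u \<in> ?T ` ereal_epigraph R" by blast
  qed (use \<gamma> in \<open>auto simp: ereal_epigraph_def eq\<close>)
  moreover have lin: "linear ?T"
    by (rule linearI) (auto simp: algebra_simps)
  moreover have "inj ?T" using \<gamma> by (auto simp: inj_on_def)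
  ultimately have "closed (ereal_epigraph (\<lambda>z. ereal \<gamma> * R z))" "convex (ereal_epigraph (\<lambda>z. ereal \<gamma> * R z))"
    using R by (auto simp: proper_closed_convex_def intro: closed_injective_linear_image convex_linear_image)
  then show ?thesis
    using R \<gamma> by (auto simp: proper_closed_convex_def ereal_mult_eq_PInfty ereal_mult_eq_MInfty)
qed

text \<open>The choice operator in \<^const>\<open>prox\<close> is only meaningful once a minimizer exists. The affine minorant
  of \<open>R\<close> makes the sublevel set of the objective, viewed inside the epigraph, compact.\<close>

lemma is_arg_min_prox:
  fixes R :: "'a::euclidean_space \<Rightarrow> ereal"
  assumes R: "proper_closed_convex R"
    and x: "R x = ereal r"
    and minorant: "\<And>z s. R z = ereal s \<Longrightarrow> r - s \<le> (z - x) \<bullet> g"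
    and \<gamma>: "\<gamma> > 0"
  shows "is_arg_min (\<lambda>z. ereal \<gamma> * R z + ereal (1 / 2 * (norm (z - w))\<^sup>2)) (\<lambda>_. True) (prox \<gamma> R w)"
proof -
  let ?\<phi> = "\<lambda>z. ereal \<gamma> * R z + ereal (1 / 2 * (norm (z - w))\<^sup>2)"
  \<comment> \<open>\<open>\<psi>\<close> lifts the objective to the epigraph, with the height in
    place of \<open>R z\<close>. The lift is continuous, so it attains its infimum on a compact
    set.\<close>
  define \<psi> where "\<psi> u = \<gamma> * snd u + 1 / 2 * (norm (fst u - w))\<^sup>2" for u :: "'a \<times> real"
  define S where "S = ereal_epigraph R \<inter> {u. \<psi> u \<le> \<psi> (x, r)}"
  have cont: "continuous_on T \<psi>" for T
    unfolding \<psi>_def by (intro continuous_intros)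
  have minorant': "r - t \<le> (z - x) \<bullet> g" if Rz: "R z \<le> ereal t" for z t
  proof -
    obtain s where s: "R z = ereal s"
      using Rz R by (cases "R z") (auto simp: proper_closed_convex_def)
    then show ?thesis using minorant[OF s] Rz by simp
  qed
  have "closed S"
    unfolding S_def using R cont
    by (intro closed_Int closed_Collect_le) (auto simp: proper_closed_convex_def)
  moreover have "bounded S"
  proof -
    \<comment> \<open>With \<open>R\<close> replaced by its affine minorant, completing the square
      turns the objective into half the squared distance to \<open>q\<close> plus a constant.
      Comparison with \<open>(x, r)\<close> thus puts \<open>z\<close> in the ball about
      \<open>q\<close> through \<open>x\<close>.\<close>
    define q where "q = w + \<gamma> *\<^sub>R g"
    define K where "K = (norm (x - q))\<^sup>2"
    have 1: "(norm (z - q))\<^sup>2 \<le> K \<and> r - (z - x) \<bullet> g \<le> t \<and> \<gamma> * t \<le> \<psi> (x, r)" if "(z, t) \<in> S" for z t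
    proof -
      have 1: "r - (z - x) \<bullet> g \<le> t" and 2: "\<psi> (z, t) \<le> \<psi> (x, r)"
        using that minorant' by (auto simp: S_def ereal_epigraph_def algebra_simps)
      have "\<gamma> * (r - (z - x) \<bullet> g) \<le> \<gamma> * t" using 1 \<gamma> by (intro mult_left_mono) auto
      then have "\<gamma> * (r - (z - x) \<bullet> g) + 1 / 2 * (norm (z - w))\<^sup>2 \<le> \<gamma> * r + 1 / 2 * (norm (x - w))\<^sup>2"
        using 2 by (simp add: \<psi>_def)
      then have "(norm (z - q))\<^sup>2 \<le> K"
        unfolding K_def q_def power2_norm_eq_inner
        by (simp add: inner_diff_left inner_diff_right inner_add_left inner_add_right inner_commute algebra_simps)
      moreover have "\<gamma> * t \<le> \<psi> (x, r)" using 2 zero_le_power2[of "norm (z - w)"]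
        unfolding \<psi>_def fst_conv snd_conv by linarith
      ultimately show ?thesis using 1 by simp
    qed
    define B where "B = norm (x - q)"
    have "S \<subseteq> cball q B \<times> {r - (B + norm (q - x)) * norm g .. \<psi> (x, r) / \<gamma>}"
    proof (clarify)
      fix z t assume "(z, t) \<in> S"
      note 2 = 1[OF this]
      have zq: "norm (z - q) \<le> B" using 2 by (simp add: K_def B_def)
      have "(z - x) \<bullet> g \<le> norm (z - x) * norm g" by (rule norm_cauchy_schwarz)
      also have "\<dots> \<le> (B + norm (q - x)) * norm g"
        using norm_triangle_ineq[of "z - q" "q - x"] zq by (intro mult_right_mono) auto
      finally have "r - (B + norm (q - x)) * norm g \<le> t" using 2 by linarith
      moreover have "t \<le> \<psi> (x, r) / \<gamma>" using 2 \<gamma> by (simp add: field_simps)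
      ultimately show "z \<in> cball q B \<and> t \<in> {r - (B + norm (q - x)) * norm g .. \<psi> (x, r) / \<gamma>}"
        using zq by (simp add: dist_norm norm_minus_commute)
    qed
    then show ?thesis by (rule bounded_subset[rotated]) (intro bounded_Times bounded_cball bounded_closed_interval)
  qed
  ultimately have "compact S" by (simp add: compact_eq_bounded_closed)
  moreover have "(x, r) \<in> S" using x by (simp add: S_def ereal_epigraph_def)
  ultimately obtain u where u: "u \<in> S" "\<And>v. v \<in> S \<Longrightarrow> \<psi> u \<le> \<psi> v"
    using continuous_attains_inf[of S \<psi>] cont by (metis empty_iff)
  \<comment> \<open>Points of the graph outside \<open>S\<close> exceed
    \<open>\<psi> (x, r)\<close>, so \<open>u\<close> beats every point of the graph; and the
    objective at \<open>fst u\<close> is at most \<open>\<psi> u\<close>, as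
    \<open>R (fst u) \<le> snd u\<close>.\<close>
  have "?\<phi> (fst u) \<le> ?\<phi> z" for z
  proof (cases "R z")
    case (real s)
    have "\<psi> u \<le> \<psi> (z, s)"
    proof (cases "(z, s) \<in> S")
      case False
      then have "\<psi> (x, r) < \<psi> (z, s)" using real by (simp add: S_def ereal_epigraph_def)
      then show ?thesis using u(2)[OF \<open>(x, r) \<in> S\<close>] by simp
    qed (rule u(2))
    moreover obtain s' where "R (fst u) = ereal s'" "s' \<le> snd u"
      using u(1) R by (cases u, cases "R (fst u)") (auto simp: S_def ereal_epigraph_def proper_closed_convex_def)
    moreover have "\<gamma> * s' \<le> \<gamma> * snd u" using \<open>s' \<le> snd u\<close> \<gamma> by simp
    ultimately show ?thesis using real by (simp add: \<psi>_def)
  next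
    case PInf
    then show ?thesis using \<gamma> by simp
  next
    case MInf
    then show ?thesis using R by (simp add: proper_closed_convex_def)
  qed
  then have "is_arg_min ?\<phi> (\<lambda>_. True) (fst u)"
    by (simp add: is_arg_min_def not_less)
  then show ?thesis
    unfolding prox_def arg_min_def by (rule someI)
qed

text \<open>Since \<open>x\<close> is the proximal point of \<open>x - \<gamma> *\<^sub>R g\<close>,
  this is nonexpansiveness of the proximal map between \<open>w\<close> and that point.\<close>

lemma prox_dist_minimizer:
  fixes R :: "'a::euclidean_space \<Rightarrow> ereal" and f :: "'a \<Rightarrow> real"
  assumes R: "proper_closed_convex R"
    and min: "is_arg_min (\<lambda>z. R z + ereal (f z)) (\<lambda>_. True) x"
    and D: "GDERIV f x :> g"
    and \<gamma>: "\<gamma> > 0"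
  shows "norm (prox \<gamma> R w - x) \<le> norm (w - x + \<gamma> *\<^sub>R g)"
proof -
  let ?z = "prox \<gamma> R w"
  obtain r where r: "R x = ereal r"
    using arg_min_finite[OF R min] by blast
  have minorant: "r - s \<le> (z - x) \<bullet> g" if "R z = ereal s" for z s
    using R min D r that by (rule arg_min_variational)
  note min' = is_arg_min_prox[OF R r minorant \<gamma>, of w]
  note R' = proper_closed_convex_scale[OF R \<gamma>]
  obtain s' where s': "ereal \<gamma> * R ?z = ereal s'"
    using arg_min_finite[OF R' min'] by blast
  then obtain s where s: "R ?z = ereal s" "s' = \<gamma> * s"
    using \<gamma> by (cases "R ?z") auto
  have "GDERIV (\<lambda>z. 1 / 2 * (norm (z - w))\<^sup>2) ?z :> ?z - w"
    using GDERIV_mult[OF GDERIV_const[of "1 / 2"] GDERIV_norm_squared[of w ?z]] by simp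
  from arg_min_variational[OF R' min' this s', of x "\<gamma> * r"]
  have "\<gamma> * s - \<gamma> * r \<le> (x - ?z) \<bullet> (?z - w)"
    using r s by simp
  moreover have "\<gamma> * (r - s) \<le> \<gamma> * ((?z - x) \<bullet> g)"
    using minorant[OF s(1)] \<gamma> by (intro mult_left_mono) auto
  \<comment> \<open>The variational inequalities at \<open>?z\<close> and at \<open>x\<close> are
    added, whereby \<open>r\<close> and \<open>s\<close> cancel.\<close>
  ultimately have "(norm (?z - x))\<^sup>2 \<le> (w - x + \<gamma> *\<^sub>R g) \<bullet> (?z - x)"
    by (simp add: power2_norm_eq_inner inner_diff_left inner_diff_right inner_add_left inner_commute algebra_simps)
  also have "\<dots> \<le> norm (w - x + \<gamma> *\<^sub>R g) * norm (?z - x)"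
    by (rule norm_cauchy_schwarz)
  finally show ?thesis
    by (cases "?z = x") (auto simp: power2_eq_square)
qed

section \<open>Sampling without replacement\<close>

text \<open>Removing \<open>B\<close> is a bijection onto the subsets of \<open>X - B\<close> with
  \<open>N - card B\<close> elements. Taking a singleton or a pair for \<open>B\<close> counts the
  samples that contain one or two given indices.\<close>

lemma card_supersets:
  assumes X: "finite X" and B: "B \<subseteq> X" and N: "card B \<le> N"
  shows "card {A. A \<subseteq> X \<and> card A = N \<and> B \<subseteq> A} = (card X - card B) choose (N - card B)"
proof -
  have fB: "finite B" using X B finite_subset by blast
  have "bij_betw (\<lambda>A. A \<union> B) {A. A \<subseteq> X - B \<and> card A = N - card B} {A. A \<subseteq> X \<and> card A = N \<and> B \<subseteq> A}"
  proof (rule bij_betwI[where g = "\<lambda>A. A - B"])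
    show "(\<lambda>A. A \<union> B) \<in> {A. A \<subseteq> X - B \<and> card A = N - card B} \<rightarrow> {A. A \<subseteq> X \<and> card A = N \<and> B \<subseteq> A}"
    proof
      fix A assume A: "A \<in> {A. A \<subseteq> X - B \<and> card A = N - card B}"
      then have "finite A" using X finite_subset by blast
      then have "card (A \<union> B) = card A + card B"
        using A fB by (intro card_Un_disjoint) auto
      then show "A \<union> B \<in> {A. A \<subseteq> X \<and> card A = N \<and> B \<subseteq> A}"
        using A B N by auto
    qed
    show "(\<lambda>A. A - B) \<in> {A. A \<subseteq> X \<and> card A = N \<and> B \<subseteq> A} \<rightarrow> {A. A \<subseteq> X - B \<and> card A = N - card B}"
      using fB card_Diff_subset[OF fB] by blast
    show "A \<union> B - B = A" if "A \<in> {A. A \<subseteq> X - B \<and> card A = N - card B}" for A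
      using that by blast
    show "A - B \<union> B = A" if "A \<in> {A. A \<subseteq> X \<and> card A = N \<and> B \<subseteq> A}" for A
      using that by blast
  qed
  then have "card {A. A \<subseteq> X \<and> card A = N \<and> B \<subseteq> A} = card {A. A \<subseteq> X - B \<and> card A = N - card B}"
    by (rule bij_betw_same_card[symmetric])
  also have "\<dots> = card (X - B) choose (N - card B)"
    using X by (intro n_subsets) simp
  finally show ?thesis using B fB by (simp add: card_Diff_subset)
qed

lemma finite_size_subsets: "finite (size_subsets M N)"
  unfolding size_subsets_def by simp

lemma card_size_subsets: "card (size_subsets M N) = M choose N"
  using n_subsets[of "{1..M}" N] by (simp add: size_subsets_def)

lemma sum_size_subsets_member:
  assumes "m \<in> {1..M}" and "1 \<le> N" and "N \<le> M"
  shows "(\<Sum>A\<in>size_subsets M N. of_bool (m \<in> A)) = real N / real M * real (M choose N)"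
proof -
  have "(\<Sum>A\<in>size_subsets M N. of_bool (m \<in> A)) = real (card {A. A \<subseteq> {1..M} \<and> card A = N \<and> {m} \<subseteq> A})"
    using finite_size_subsets[of M N] by (simp add: of_bool_def sum.If_cases size_subsets_def Int_def conj_ac)
  also have "\<dots> = real ((M - 1) choose (N - 1))"
    using assms by (subst card_supersets) auto
  also have "N * (M choose N) = M * ((M - 1) choose (N - 1))"
    using assms binomial_absorption[of "N - 1" M] by simp
  then have "real ((M - 1) choose (N - 1)) = real N / real M * real (M choose N)"
    using assms by (simp add: field_simps flip: of_nat_mult)
  finally show ?thesis .
qed

lemma sum_size_subsets_pair:
  assumes "m \<in> {1..M}" and "l \<in> {1..M}" and "m \<noteq> l" and "1 \<le> N" and "N \<le> M"
  shows "(\<Sum>A\<in>size_subsets M N. of_bool (m \<in> A \<and> l \<in> A))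
    = real N * (real N - 1) / (real M * (real M - 1)) * real (M choose N)"
proof -
  have M: "2 \<le> M" using assms by auto
  have eq: "(\<Sum>A\<in>size_subsets M N. of_bool (m \<in> A \<and> l \<in> A))
      = real (card {A. A \<subseteq> {1..M} \<and> card A = N \<and> {m, l} \<subseteq> A})"
    using finite_size_subsets[of M N] by (simp add: of_bool_def sum.If_cases size_subsets_def Int_def conj_ac)
  show ?thesis
  \<comment> \<open>A sample of size 1 contains no pair, while truncated subtraction would count
    \<open>(M - 2) choose 0\<close>, which is 1. For larger \<open>N\<close>, the absorption
    identity is used twice.\<close>
  proof (cases "N = 1")
    case True
    have "{A. A \<subseteq> {1..M} \<and> card A = N \<and> {m, l} \<subseteq> A} = {}"
      using True assms by (auto simp: card_1_singleton_iff)
    then have "card {A. A \<subseteq> {1..M} \<and> card A = N \<and> {m, l} \<subseteq> A} = 0" by (simp only: card.empty)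
    then show ?thesis using True eq by simp
  next
    case False
    have "card {A. A \<subseteq> {1..M} \<and> card A = N \<and> {m, l} \<subseteq> A} = (M - 2) choose (N - 2)"
      using card_supersets[of "{1..M}" "{m, l}" N] assms False by (auto simp: numeral_2_eq_2)
    moreover have "N * (M choose N) = M * ((M - 1) choose (N - 1))"
      using assms binomial_absorption[of "N - 1" M] by simp
    moreover have "Suc (N - 2) = N - 1" "M - 1 - 1 = M - 2" using assms False by auto
    with binomial_absorption[of "N - 2" "M - 1"]
    have "(N - 1) * ((M - 1) choose (N - 1)) = (M - 1) * ((M - 2) choose (N - 2))"
      by (simp only:)
    ultimately have "real N * real (M choose N) = real M * real ((M - 1) choose (N - 1))"
      and "real (N - 1) * real ((M - 1) choose (N - 1)) = real (M - 1) * (\<Sum>A\<in>size_subsets M N. of_bool (m \<in> A \<and> l \<in> A))"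
      unfolding eq by (simp_all only: flip: of_nat_mult)
    moreover have "real (N - 1) = real N - 1" "real (M - 1) = real M - 1" using assms by auto
    ultimately have "real N * real (M choose N) = real M * real ((M - 1) choose (N - 1))"
      and "(real N - 1) * real ((M - 1) choose (N - 1)) = (real M - 1) * (\<Sum>A\<in>size_subsets M N. of_bool (m \<in> A \<and> l \<in> A))"
      by (simp_all only:)
    then have "(\<Sum>A\<in>size_subsets M N. of_bool (m \<in> A \<and> l \<in> A)) * (real M * (real M - 1))
        = real N * (real N - 1) * real (M choose N)"
      by algebra
    moreover have "real M * (real M - 1) \<noteq> 0" using M by simp
    ultimately show ?thesis by (simp add: nonzero_eq_divide_eq)
  qed
qed

lemma sum_of_bool_scaleR:
  fixes v :: "'b \<Rightarrow> 'a::real_vector"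
  assumes "A \<subseteq> X" and "finite X"
  shows "(\<Sum>m\<in>A. v m) = (\<Sum>m\<in>X. of_bool (m \<in> A) *\<^sub>R v m)"
  using assms by (intro sum.mono_neutral_cong_left) auto

lemma sum_size_subsets_sum:
  fixes v :: "nat \<Rightarrow> 'a::real_vector"
  assumes "1 \<le> N" and "N \<le> M"
  shows "(\<Sum>A\<in>size_subsets M N. \<Sum>m\<in>A. v m) = (real N / real M * real (M choose N)) *\<^sub>R (\<Sum>m=1..M. v m)"
proof -
  have "(\<Sum>A\<in>size_subsets M N. \<Sum>m\<in>A. v m) = (\<Sum>A\<in>size_subsets M N. \<Sum>m=1..M. of_bool (m \<in> A) *\<^sub>R v m)"
    by (intro sum.cong refl sum_of_bool_scaleR) (auto simp: size_subsets_def)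
  also have "\<dots> = (\<Sum>m=1..M. (\<Sum>A\<in>size_subsets M N. of_bool (m \<in> A)) *\<^sub>R v m)"
    by (subst sum.swap) (simp add: scaleR_left.sum)
  also have "\<dots> = (\<Sum>m=1..M. (real N / real M * real (M choose N)) *\<^sub>R v m)"
    using assms by (intro sum.cong refl) (simp add: sum_size_subsets_member)
  finally show ?thesis by (simp add: scaleR_sum_right)
qed

text \<open>The square is expanded into inner products weighted by inclusion counts,
  \<open>n1\<close> on the diagonal and \<open>n2\<close> off it. The part with the constant weight
  \<open>n2\<close> is the squared norm of the total, which is zero, so \<open>n1 - n2\<close> on
  the diagonal remains.\<close>

lemma sum_size_subsets_norm_squared:
  fixes v :: "nat \<Rightarrow> 'a::real_inner"
  assumes N: "1 \<le> N" "N \<le> M" and v: "(\<Sum>m=1..M. v m) = 0"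
  shows "(\<Sum>A\<in>size_subsets M N. (norm (\<Sum>m\<in>A. v m))\<^sup>2)
    = real N * (real M - real N) / (real M * (real M - 1)) * real (M choose N) * (\<Sum>m=1..M. (norm (v m))\<^sup>2)"
proof -
  define B where "B = real (M choose N)"
  define n1 where "n1 = real N / real M * B"
  define n2 where "n2 = real N * (real N - 1) / (real M * (real M - 1)) * B"
  have "(norm (\<Sum>m\<in>A. v m))\<^sup>2 = (\<Sum>m=1..M. \<Sum>l=1..M. of_bool (m \<in> A \<and> l \<in> A) * (v m \<bullet> v l))"
    if "A \<in> size_subsets M N" for A
  proof -
    have A: "A \<subseteq> {1..M}" using that by (simp add: size_subsets_def)
    have "(norm (\<Sum>m\<in>A. v m))\<^sup>2 = (\<Sum>m\<in>A. \<Sum>l\<in>A. v m \<bullet> v l)"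
      unfolding power2_norm_eq_inner inner_sum_left inner_sum_right by (rule sum.swap)
    also have "\<dots> = (\<Sum>m=1..M. of_bool (m \<in> A) * (\<Sum>l=1..M. of_bool (l \<in> A) * (v m \<bullet> v l)))"
      using sum_of_bool_scaleR[OF A, where 'a = real] by simp
    finally show ?thesis
      by (simp add: of_bool_conj sum_distrib_left mult.assoc del: sum_mult_of_bool_eq sum_of_bool_mult_eq)
  qed
  then have "(\<Sum>A\<in>size_subsets M N. (norm (\<Sum>m\<in>A. v m))\<^sup>2)
      = (\<Sum>A\<in>size_subsets M N. \<Sum>m=1..M. \<Sum>l=1..M. of_bool (m \<in> A \<and> l \<in> A) * (v m \<bullet> v l))"
    by simp
  also have "\<dots> = (\<Sum>m=1..M. \<Sum>l=1..M. (\<Sum>A\<in>size_subsets M N. of_bool (m \<in> A \<and> l \<in> A)) * (v m \<bullet> v l))"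
    by (subst sum.swap, rule sum.cong[OF refl], subst sum.swap) (simp add: sum_distrib_right)
  also have "\<dots> = (\<Sum>m=1..M. \<Sum>l=1..M. n2 * (v m \<bullet> v l) + (if l = m then (n1 - n2) * (v m \<bullet> v m) else 0))"
  proof (intro sum.cong refl)
    fix m l assume "m \<in> {1..M}" "l \<in> {1..M}"
    then show "(\<Sum>A\<in>size_subsets M N. of_bool (m \<in> A \<and> l \<in> A)) * (v m \<bullet> v l)
        = n2 * (v m \<bullet> v l) + (if l = m then (n1 - n2) * (v m \<bullet> v m) else 0)"
      using N by (cases "l = m") (simp_all add: sum_size_subsets_member sum_size_subsets_pair n1_def n2_def B_def algebra_simps del: One_nat_def)
  qed
  also have "\<dots> = n2 * ((\<Sum>m=1..M. v m) \<bullet> (\<Sum>l=1..M. v l)) + (n1 - n2) * (\<Sum>m=1..M. (norm (v m))\<^sup>2)"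
    by (simp add: sum.distrib sum_distrib_left power2_norm_eq_inner inner_sum_left inner_sum_right inner_commute)
  also have "\<dots> = (n1 - n2) * (\<Sum>m=1..M. (norm (v m))\<^sup>2)"
    using v by simp
  finally have *: "(\<Sum>A\<in>size_subsets M N. (norm (\<Sum>m\<in>A. v m))\<^sup>2) = (n1 - n2) * (\<Sum>m=1..M. (norm (v m))\<^sup>2)" .
  show ?thesis
  \<comment> \<open>Here the coefficient in the claim is a division by zero, hence 0, and the other
    side vanishes because the only vector is zero.\<close>
  proof (cases "M = 1")
    case True
    then show ?thesis using * v by simp
  next
    case False
    then have "n1 - n2 = real N * (real M - real N) / (real M * (real M - 1)) * B"
      using N by (simp add: n1_def n2_def field_simps)
    then show ?thesis using * by (simp add: B_def)
  qed
qed

section \<open>One step of the algorithm\<close>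

lemma average_diff: "average M (\<lambda>m. u m - v m) = average M u - average M v"
  by (simp add: average_def sum_subtractf scaleR_diff_right)

lemma average_mono:
  fixes u v :: "nat \<Rightarrow> real"
  assumes "\<And>m. m \<in> {1..M} \<Longrightarrow> u m \<le> v m"
  shows "average M u \<le> average M v"
  unfolding average_def real_scaleR_def by (intro mult_left_mono sum_mono assms) auto

lemma inner_average: "z \<bullet> average M v = average M (\<lambda>m. z \<bullet> v m)"
  by (simp add: average_def inner_sum_right)

lemma average_mult: "average M (\<lambda>m. c * u m :: real) = c * average M u"
  by (simp add: average_def sum_distrib_left mult_ac)

lemma average_add: "average M (\<lambda>m. u m + v m) = average M u + average M v"
  by (simp add: average_def sum.distrib scaleR_add_right)

lemma average_const: "M \<ge> 1 \<Longrightarrow> average M (\<lambda>_. v) = v"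
  by (simp add: average_def sum_constant_scaleR)

lemma average_nonneg: "(\<And>m. 0 \<le> u m) \<Longrightarrow> 0 \<le> average M (u :: nat \<Rightarrow> real)"
  by (simp add: average_def sum_nonneg)

lemma average_variance:
  fixes v :: "nat \<Rightarrow> 'a::real_inner"
  assumes "M \<ge> 1"
  shows "average M (\<lambda>m. (norm (v m - average M v))\<^sup>2) = average M (\<lambda>m. (norm (v m))\<^sup>2) - (norm (average M v))\<^sup>2"
proof -
  let ?a = "average M v"
  have "(norm (v m - ?a))\<^sup>2 = (norm (v m))\<^sup>2 + ((-2) * (?a \<bullet> v m) + (norm ?a)\<^sup>2)" for m
    by (simp add: power2_norm_eq_inner inner_diff_left inner_diff_right inner_commute)
  then have "average M (\<lambda>m. (norm (v m - ?a))\<^sup>2)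
      = average M (\<lambda>m. (norm (v m))\<^sup>2) + ((-2) * (?a \<bullet> ?a) + (norm ?a)\<^sup>2)"
    using assms by (simp only: average_add average_mult average_const flip: inner_average)
  then show ?thesis by (simp add: power2_norm_eq_inner)
qed

lemma norm_diff_squared_le:
  fixes u v :: "'a::real_inner"
  assumes "b > 0"
  shows "(norm (u - v))\<^sup>2 \<le> (1 + b) * (norm u)\<^sup>2 + (1 + 1 / b) * (norm v)\<^sup>2"
proof -
  \<comment> \<open>The gap in the inequality is exactly this square.\<close>
  have "0 \<le> 1 / b * (norm (b *\<^sub>R u + v))\<^sup>2" using assms by simp
  also have "\<dots> = (1 + b) * (norm u)\<^sup>2 + (1 + 1 / b) * (norm v)\<^sup>2 - (norm (u - v))\<^sup>2"
    using assms by (simp add: power2_norm_eq_inner inner_diff_left inner_diff_right inner_add_left inner_add_right inner_commute field_simps)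
  finally show ?thesis by simp
qed

text \<open>Young's inequality is applied to the centred vectors, which keeps the negative term in
  \<open>average M u\<close>; this term is what permits an \<open>a\<close> below 1 in the stepsize.
  For \<open>v\<close> the variance is relaxed to the second moment.\<close>

lemma average_variance_diff_le:
  fixes u v :: "nat \<Rightarrow> 'a::real_inner"
  assumes "M \<ge> 1" and b: "b > 0"
  shows "average M (\<lambda>m. (norm (u m - v m))\<^sup>2) - (norm (average M u - average M v))\<^sup>2
    \<le> (1 + b) * (average M (\<lambda>m. (norm (u m))\<^sup>2) - (norm (average M u))\<^sup>2)
      + (1 + 1 / b) * average M (\<lambda>m. (norm (v m))\<^sup>2)"
proof -
  let ?u = "average M u" and ?v = "average M v"
  have "average M (\<lambda>m. (norm (u m - v m))\<^sup>2) - (norm (?u - ?v))\<^sup>2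
      = average M (\<lambda>m. (norm (u m - v m - (?u - ?v)))\<^sup>2)"
    using average_variance[OF assms(1), of "\<lambda>m. u m - v m"] by (simp add: average_diff)
  also have "\<dots> \<le> average M (\<lambda>m. (1 + b) * (norm (u m - ?u))\<^sup>2 + (1 + 1 / b) * (norm (v m - ?v))\<^sup>2)"
  proof (rule average_mono)
    fix m
    have "u m - v m - (?u - ?v) = (u m - ?u) - (v m - ?v)" by simp
    then show "(norm (u m - v m - (?u - ?v)))\<^sup>2 \<le> (1 + b) * (norm (u m - ?u))\<^sup>2 + (1 + 1 / b) * (norm (v m - ?v))\<^sup>2"
      using norm_diff_squared_le[OF b] by metis
  qed
  also have "\<dots> = (1 + b) * (average M (\<lambda>m. (norm (u m))\<^sup>2) - (norm ?u)\<^sup>2)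
      + (1 + 1 / b) * (average M (\<lambda>m. (norm (v m))\<^sup>2) - (norm ?v)\<^sup>2)"
    by (simp only: average_add average_mult average_variance[OF assms(1)])
  also have "\<dots> \<le> (1 + b) * (average M (\<lambda>m. (norm (u m))\<^sup>2) - (norm ?u)\<^sup>2)
      + (1 + 1 / b) * average M (\<lambda>m. (norm (v m))\<^sup>2)"
    using b by (intro add_left_mono mult_left_mono) auto
  finally show ?thesis .
qed

text \<open>Squared mean plus variance: dividing by \<open>M choose N\<close> makes the sum an
  expectation over the sample.\<close>

lemma sampling_second_moment:
  fixes D :: "nat \<Rightarrow> 'a::real_inner"
  assumes N: "1 \<le> N" "N \<le> M"
  shows "(\<Sum>A\<in>size_subsets M N. (norm (e + (1 / real N) *\<^sub>R (\<Sum>m\<in>A. D m)))\<^sup>2) / real (M choose N)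
    = (norm (e + average M D))\<^sup>2 + (real M - real N) / (real N * (real M - 1))
      * (average M (\<lambda>m. (norm (D m))\<^sup>2) - (norm (average M D))\<^sup>2)"
proof -
  \<comment> \<open>Centring makes the cross term vanish on summation and meets the zero-sum
    hypothesis of \<open>sum_size_subsets_norm_squared\<close>.\<close>
  define v where "v m = D m - average M D" for m
  define f where "f = e + average M D"
  define B where "B = real (M choose N)"
  have B: "B > 0" using N by (simp add: B_def)
  have M: "real M > 0" and N': "real N > 0" using N by auto
  have v0: "(\<Sum>m=1..M. v m) = 0"
  proof -
    have "average M v = 0" using N unfolding v_def average_diff by (simp add: average_const)
    then show ?thesis using M by (simp add: average_def)
  qed
  have "(norm (e + (1 / real N) *\<^sub>R (\<Sum>m\<in>A. D m)))\<^sup>2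
      = (norm f)\<^sup>2 + 2 / real N * (f \<bullet> (\<Sum>m\<in>A. v m)) + 1 / (real N)\<^sup>2 * (norm (\<Sum>m\<in>A. v m))\<^sup>2"
    if "A \<in> size_subsets M N" for A
  proof -
    have "card A = N" using that by (simp add: size_subsets_def)
    then have "(\<Sum>m\<in>A. D m) = (\<Sum>m\<in>A. v m) + real N *\<^sub>R average M D"
      by (simp add: v_def sum_subtractf sum_constant_scaleR)
    then have "e + (1 / real N) *\<^sub>R (\<Sum>m\<in>A. D m) = f + (1 / real N) *\<^sub>R (\<Sum>m\<in>A. v m)"
      using N' by (simp add: f_def scaleR_add_right)
    then show ?thesis
      unfolding power2_norm_eq_inner
      by (simp add: inner_add_left inner_add_right inner_commute power2_eq_square)
  qed
  then have "(\<Sum>A\<in>size_subsets M N. (norm (e + (1 / real N) *\<^sub>R (\<Sum>m\<in>A. D m)))\<^sup>2)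
      = B * (norm f)\<^sup>2 + 2 / real N * (f \<bullet> (\<Sum>A\<in>size_subsets M N. \<Sum>m\<in>A. v m))
        + 1 / (real N)\<^sup>2 * (\<Sum>A\<in>size_subsets M N. (norm (\<Sum>m\<in>A. v m))\<^sup>2)"
    by (simp add: sum.distrib card_size_subsets B_def sum_distrib_left inner_sum_right)
  also have "\<dots> = B * (norm f)\<^sup>2
      + 1 / (real N)\<^sup>2 * (real N * (real M - real N) / (real M * (real M - 1)) * B * (\<Sum>m=1..M. (norm (v m))\<^sup>2))"
    unfolding sum_size_subsets_norm_squared[OF N v0] sum_size_subsets_sum[OF N] v0 B_def by simp
  also have "(\<Sum>m=1..M. (norm (v m))\<^sup>2) = real M * (average M (\<lambda>m. (norm (D m))\<^sup>2) - (norm (average M D))\<^sup>2)"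
  proof -
    have "(\<Sum>m=1..M. (norm (v m))\<^sup>2) = real M * average M (\<lambda>m. (norm (v m))\<^sup>2)"
      using M by (simp add: average_def)
    then show ?thesis using average_variance[of M D] N by (simp add: v_def)
  qed
  finally have "(\<Sum>A\<in>size_subsets M N. (norm (e + (1 / real N) *\<^sub>R (\<Sum>m\<in>A. D m)))\<^sup>2)
      = B * ((norm f)\<^sup>2 + (real M - real N) / (real N * (real M - 1))
      * (average M (\<lambda>m. (norm (D m))\<^sup>2) - (norm (average M D))\<^sup>2))"
    using M N' by (simp add: power2_eq_square distrib_left)
  then show ?thesis using B unfolding B_def[symmetric] f_def by simp
qed

text \<open>The contraction conditional on the current state: the normalized sum averages over the
  sample, and \<open>p * V x + (1 - p) * V y\<close> averages over the coin. The full gradient at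
  \<open>y\<close> stands for \<open>h\<close>, as \<open>minibatch_lsvrg_h\<close>
  justifies.\<close>

lemma lsvrg_step:
  fixes F :: "nat \<Rightarrow> 'a::euclidean_space \<Rightarrow> real" and R :: "'a \<Rightarrow> ereal"
    and M N :: nat and L \<mu> \<gamma> p a b c \<omega> :: real and x y xs :: 'a
  assumes "L > 0"
    and convF: "\<And>m. m \<in> {1..M} \<Longrightarrow> convex_on UNIV (F m)"
    and smooth: "\<And>m. m \<in> {1..M} \<Longrightarrow> L_smooth L (F m)"
    and sc: "strongly_convex \<mu> (\<lambda>z. average M (\<lambda>m. F m z))"
    and R: "proper_closed_convex R"
    and min: "is_arg_min (\<lambda>z. R z + ereal (average M (\<lambda>m. F m z))) (\<lambda>_. True) xs"
    and N: "1 \<le> N" "N \<le> M" and p: "0 < p" and b: "b > 1"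
    and \<omega>: "\<omega> = (real M - real N) / (real N * (real M - 1))"
    and a: "a = max (1 - (1 + b) * \<omega>) 0"
    and \<gamma>: "0 < \<gamma>" "\<gamma> \<le> 1 / L * (1 / (a + (1 + b)\<^sup>2 * \<omega>))"
    and c: "c = 1 - min (\<gamma> * \<mu>) (p * (1 - 1 / b\<^sup>2))"
    and C: "C = (b\<^sup>2 + b) * \<gamma>\<^sup>2 * \<omega> / p"
    and V: "\<And>z. V z = average M (\<lambda>m. (norm (grad (F m) z - grad (F m) xs))\<^sup>2)"
  shows "(\<Sum>A\<in>size_subsets M N. (norm (prox \<gamma> R (x - \<gamma> *\<^sub>R (average M (\<lambda>m. grad (F m) y)
        + (1 / real N) *\<^sub>R (\<Sum>m\<in>A. grad (F m) x - grad (F m) y))) - xs))\<^sup>2) / real (M choose N)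
      + C * (p * V x + (1 - p) * V y)
    \<le> c * ((norm (x - xs))\<^sup>2 + C * V y)"
proof -
  define G where "G z = average M (\<lambda>m. grad (F m) z)" for z
  define U where "U m = grad (F m) x - grad (F m) xs" for m
  define W where "W m = grad (F m) y - grad (F m) xs" for m
  have M: "M \<ge> 1" using N by simp
  have \<omega>0: "\<omega> \<ge> 0" using N unfolding \<omega> by (intro divide_nonneg_nonneg mult_nonneg_nonneg) auto
  have V0: "V z \<ge> 0" for z unfolding V by (rule average_nonneg) simp
  have D: "GDERIV (\<lambda>z. average M (\<lambda>m. F m z)) z :> G z" for z
    unfolding G_def using smooth by (intro GDERIV_average GDERIV_grad) (simp add: L_smooth_def)
  have avgU: "average M U = G x - G xs" and avgW: "average M W = G y - G xs"
    unfolding U_def W_def G_def by (simp_all add: average_diff)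
  let ?q = "\<lambda>A. prox \<gamma> R (x - \<gamma> *\<^sub>R (average M (\<lambda>m. grad (F m) y)
        + (1 / real N) *\<^sub>R (\<Sum>m\<in>A. grad (F m) x - grad (F m) y)))"
  \<comment> \<open>The vector in \<open>prox_dist_minimizer\<close> is split into a fixed part
    \<open>e\<close> and a sampled mean of the \<open>E m\<close>; passing through \<open>xs\<close>
    exposes \<open>U\<close> and \<open>W\<close>, to which Young's inequality is applied.\<close>
  define e where "e = x - xs - \<gamma> *\<^sub>R (G y - G xs)"
  define E where "E m = (- \<gamma>) *\<^sub>R (U m - W m)" for m
  have avgE: "average M E = (- \<gamma>) *\<^sub>R (G x - G y)"
    unfolding E_def average_def by (simp add: U_def W_def G_def average_def sum_subtractf scaleR_diff_right flip: scaleR_sum_right)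
  have normE: "average M (\<lambda>m. (norm (E m))\<^sup>2) - (norm (average M E))\<^sup>2
      = \<gamma>\<^sup>2 * (average M (\<lambda>m. (norm (U m - W m))\<^sup>2) - (norm (average M U - average M W))\<^sup>2)"
    unfolding avgE avgU avgW by (simp add: E_def power_mult_distrib average_mult right_diff_distrib)
  have "(norm (?q A - xs))\<^sup>2 \<le> (norm (e + (1 / real N) *\<^sub>R (\<Sum>m\<in>A. E m)))\<^sup>2" for A
  proof (rule power_mono)
    have "norm (?q A - xs) \<le> norm (x - \<gamma> *\<^sub>R (G y + (1 / real N) *\<^sub>R (\<Sum>m\<in>A. grad (F m) x - grad (F m) y)) - xs + \<gamma> *\<^sub>R G xs)"
      unfolding G_def[of y] by (rule prox_dist_minimizer[OF R min D \<gamma>(1)])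
    moreover have "(\<Sum>m\<in>A. E m) = (- \<gamma>) *\<^sub>R (\<Sum>m\<in>A. grad (F m) x - grad (F m) y)"
      by (simp only: E_def U_def W_def scaleR_sum_right diff_diff_eq2 diff_add_cancel)
    then have "e + (1 / real N) *\<^sub>R (\<Sum>m\<in>A. E m)
        = x - \<gamma> *\<^sub>R (G y + (1 / real N) *\<^sub>R (\<Sum>m\<in>A. grad (F m) x - grad (F m) y)) - xs + \<gamma> *\<^sub>R G xs"
      by (simp add: e_def scaleR_diff_right scaleR_add_right)
    ultimately show "norm (?q A - xs) \<le> norm (e + (1 / real N) *\<^sub>R (\<Sum>m\<in>A. E m))"
      by (simp only:)
  qed simp
  then have "(\<Sum>A\<in>size_subsets M N. (norm (?q A - xs))\<^sup>2) / real (M choose N)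
      \<le> (\<Sum>A\<in>size_subsets M N. (norm (e + (1 / real N) *\<^sub>R (\<Sum>m\<in>A. E m)))\<^sup>2) / real (M choose N)"
    by (intro divide_right_mono sum_mono) auto
  also have "\<dots> = (norm (e + average M E))\<^sup>2 + \<omega> * (average M (\<lambda>m. (norm (E m))\<^sup>2) - (norm (average M E))\<^sup>2)"
    unfolding \<omega> by (rule sampling_second_moment[OF N])
  \<comment> \<open>Unbiasedness: the mean no longer involves \<open>y\<close>.\<close>
  also have "e + average M E = (x - xs) - \<gamma> *\<^sub>R average M U"
    unfolding avgE avgU e_def by (simp add: algebra_simps)
  also have "(norm ((x - xs) - \<gamma> *\<^sub>R average M U))\<^sup>2
      = (norm (x - xs))\<^sup>2 - 2 * \<gamma> * ((x - xs) \<bullet> average M U) + \<gamma>\<^sup>2 * (norm (average M U))\<^sup>2"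
    unfolding power2_norm_eq_inner
    by (simp add: inner_diff_left inner_diff_right inner_commute power2_eq_square algebra_simps)
  finally have 1: "(\<Sum>A\<in>size_subsets M N. (norm (?q A - xs))\<^sup>2) / real (M choose N)
    \<le> (norm (x - xs))\<^sup>2 - 2 * \<gamma> * ((x - xs) \<bullet> average M U) + \<gamma>\<^sup>2 * (norm (average M U))\<^sup>2
      + \<omega> * (\<gamma>\<^sup>2 * (average M (\<lambda>m. (norm (U m - W m))\<^sup>2) - (norm (average M U - average M W))\<^sup>2))"
    unfolding normE .
  have "average M (\<lambda>m. (norm (U m - W m))\<^sup>2) - (norm (average M U - average M W))\<^sup>2
      \<le> (1 + b) * (V x - (norm (average M U))\<^sup>2) + (1 + 1 / b) * V y"
    using average_variance_diff_le[OF M, of b U W] b by (simp add: V U_def W_def)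
  then have 2: "\<omega> * (\<gamma>\<^sup>2 * (average M (\<lambda>m. (norm (U m - W m))\<^sup>2) - (norm (average M U - average M W))\<^sup>2))
      \<le> \<omega> * (\<gamma>\<^sup>2 * ((1 + b) * (V x - (norm (average M U))\<^sup>2) + (1 + 1 / b) * V y))"
    using \<omega>0 by (intro mult_left_mono) auto
  have U_le: "(norm (average M U))\<^sup>2 \<le> V x"
    using average_variance[OF M, of U] average_nonneg[of "\<lambda>m. (norm (U m - average M U))\<^sup>2" M]
    by (simp add: V U_def)
  \<comment> \<open>The coefficient may be negative, so it is first raised to \<open>a\<close>; only
    a nonnegative factor may be combined with \<open>U_le\<close>.\<close>
  have "(1 - (1 + b) * \<omega>) * (norm (average M U))\<^sup>2 \<le> a * (norm (average M U))\<^sup>2"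
    unfolding a by (intro mult_right_mono) auto
  also have "\<dots> \<le> a * V x" using U_le by (intro mult_left_mono) (auto simp: a)
  finally have "\<gamma>\<^sup>2 * ((1 - (1 + b) * \<omega>) * (norm (average M U))\<^sup>2) \<le> \<gamma>\<^sup>2 * (a * V x)"
    by (intro mult_left_mono) auto
  with 1 2 have 3: "(\<Sum>A\<in>size_subsets M N. (norm (?q A - xs))\<^sup>2) / real (M choose N)
    \<le> (norm (x - xs))\<^sup>2 - 2 * \<gamma> * ((x - xs) \<bullet> average M U)
      + \<gamma>\<^sup>2 * ((a + (1 + b) * \<omega>) * V x) + \<omega> * \<gamma>\<^sup>2 * (1 + 1 / b) * V y"
    by (simp add: algebra_simps)
  have Cp: "C * p = (b\<^sup>2 + b) * \<gamma>\<^sup>2 * \<omega>" using p by (simp add: C)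
  \<comment> \<open>The total coefficient of \<open>V x\<close> over
    \<open>\<gamma>\<^sup>2\<close>: \<open>a + (1 + b) * \<omega>\<close> from the variance bound
    and \<open>(b\<^sup>2 + b) * \<omega>\<close> from \<open>C * p\<close>.\<close>
  define S where "S = a + (1 + b)\<^sup>2 * \<omega>"
  have S0: "S > 0"
  proof -
    have "a \<ge> 0" by (simp add: a)
    then have "S \<ge> 0" using \<omega>0 by (simp add: S_def)
    \<comment> \<open>With \<open>S = 0\<close> the stepsize bound would read
      \<open>\<gamma> \<le> 0\<close>, as \<open>1 / 0 = 0\<close>.\<close>
    moreover have "S \<noteq> 0" using \<gamma> unfolding S_def[symmetric] by auto
    ultimately show ?thesis by simp
  qed
  have "\<gamma> * S \<le> 1 / L"
    using \<gamma>(2) S0 \<open>L > 0\<close> unfolding S_def[symmetric] by (simp add: field_simps)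
  \<comment> \<open>Of the two copies of \<open>\<gamma> * ((x - xs) \<bullet> average M U)\<close>,
    one pays for \<open>V x\<close> through the stepsize bound and cocoercivity, the other yields
    the factor \<open>1 - \<gamma> * \<mu>\<close>.\<close>
  then have "\<gamma> * (\<gamma> * S * V x) \<le> \<gamma> * (1 / L * V x)"
    using \<gamma>(1) V0 by (intro mult_left_mono mult_right_mono) auto
  moreover have coco: "1 / L * V x \<le> (x - xs) \<bullet> average M U"
    unfolding V average_mult[symmetric] inner_average U_def
    using convF smooth \<open>L > 0\<close> by (intro average_mono cocoercive) auto
  moreover have "\<mu> * (norm (x - xs))\<^sup>2 \<le> (x - xs) \<bullet> average M U"
    unfolding avgU using sc D by (rule strongly_convex_monotone)
  then have "\<gamma> * (\<mu> * (norm (x - xs))\<^sup>2) \<le> \<gamma> * ((x - xs) \<bullet> average M U)"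
    using \<gamma>(1) by (intro mult_left_mono) auto
  moreover have "\<gamma> * (1 / L * V x) \<le> \<gamma> * ((x - xs) \<bullet> average M U)"
    using coco \<gamma>(1) by (intro mult_left_mono) auto
  moreover have "C * p * V x + \<gamma>\<^sup>2 * ((a + (1 + b) * \<omega>) * V x) = \<gamma> * (\<gamma> * S * V x)"
    unfolding Cp S_def by (simp add: power2_eq_square algebra_simps)
  ultimately have "(norm (x - xs))\<^sup>2 - 2 * \<gamma> * ((x - xs) \<bullet> average M U)
      + \<gamma>\<^sup>2 * ((a + (1 + b) * \<omega>) * V x) + C * p * V x \<le> (1 - \<gamma> * \<mu>) * (norm (x - xs))\<^sup>2"
    by (simp add: algebra_simps)
  \<comment> \<open>A refresh removes \<open>C * p\<close> from the weight of \<open>V y\<close>,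
    and Young's remainder returns the fraction \<open>1 / b\<^sup>2\<close> of it; hence the rate
    \<open>p * (1 - 1 / b\<^sup>2)\<close>.\<close>
  moreover have "\<omega> * \<gamma>\<^sup>2 * (1 + 1 / b) = C * p / b\<^sup>2"
    unfolding Cp using b by (simp add: field_simps power2_eq_square)
  ultimately have "(\<Sum>A\<in>size_subsets M N. (norm (?q A - xs))\<^sup>2) / real (M choose N)
      + C * (p * V x + (1 - p) * V y)
    \<le> (1 - \<gamma> * \<mu>) * (norm (x - xs))\<^sup>2 + (C * p / b\<^sup>2 + C * (1 - p)) * V y"
    using 3 by (simp add: algebra_simps)
  also have "(C * p / b\<^sup>2 + C * (1 - p)) * V y = (1 - p * (1 - 1 / b\<^sup>2)) * (C * V y)"
    by (simp add: algebra_simps)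
  also have "(1 - \<gamma> * \<mu>) * (norm (x - xs))\<^sup>2 + (1 - p * (1 - 1 / b\<^sup>2)) * (C * V y)
      \<le> c * (norm (x - xs))\<^sup>2 + c * (C * V y)"
  proof (intro add_mono mult_right_mono)
    show "0 \<le> C * V y" using b p \<omega>0 V0 by (simp add: C)
  qed (auto simp: c)
  finally show ?thesis by (simp add: distrib_left)
qed

section \<open>Independence with finitely many values\<close>

text \<open>Every function on a \<open>count_space\<close> is measurable and finitely many values
  are bounded, so no regularity of the maps in the algorithm has to be shown.\<close>

lemma (in prob_space) integrable_finite_range:
  fixes f :: "'b \<Rightarrow> real"
  assumes Z: "Z \<in> measurable M (count_space S)" and S: "finite S"
  shows "integrable M (\<lambda>w. f (Z w))"
proof (rule integrable_const_bound)
  show "AE w in M. norm (f (Z w)) \<le> (\<Sum>z\<in>S. \<bar>f z\<bar>)"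
    using measurable_space[OF Z] S by (intro AE_I2) (auto intro!: member_le_sum)
  show "(\<lambda>w. f (Z w)) \<in> borel_measurable M"
    using Z by (rule measurable_compose) simp
qed

text \<open>Splitting over the values of \<open>g (Y w)\<close> gives products of a function of
  \<open>Z\<close> and an indicator, which independence factorizes. \<open>g\<close> permits
  averaging over one component of a pair alone.\<close>

lemma (in prob_space) expectation_indep_finite:
  fixes f :: "'b \<Rightarrow> 'c \<Rightarrow> real"
  assumes ind: "indep_var (count_space S) Z (count_space S') Y" and S: "finite S"
    and g: "g \<in> S' \<rightarrow> T" and T: "finite T"
  shows "expectation (\<lambda>w. f (Z w) (g (Y w)))
    = (\<Sum>t\<in>T. prob {w \<in> space M. g (Y w) = t} * expectation (\<lambda>w. f (Z w) t))"
proof -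
  let ?X = "\<lambda>w. g (Y w)"
  have Z: "Z \<in> measurable M (count_space S)" and Y: "Y \<in> measurable M (count_space S')"
    using ind by (auto dest: indep_var_rv1 indep_var_rv2)
  have X: "?X \<in> measurable M (count_space T)"
    using Y by (rule measurable_compose) (use g in auto)
  have ind': "indep_var borel (\<lambda>w. f (Z w) t) borel (\<lambda>w. indicator {t} (?X w) :: real)" for t
    using indep_var_compose[OF ind, of "\<lambda>z. f z t" borel "\<lambda>y. indicator {t} (g y)" borel]
    by (simp add: o_def)
  note int = integrable_finite_range[OF Z S] integrable_finite_range[OF X T]
  have "expectation (\<lambda>w. f (Z w) (?X w)) = expectation (\<lambda>w. \<Sum>t\<in>T. f (Z w) t * indicator {t} (?X w))"
  proof (rule Bochner_Integration.integral_cong[OF refl])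
    fix w assume "w \<in> space M"
    then have "?X w \<in> T" using measurable_space[OF X] by simp
    then show "f (Z w) (?X w) = (\<Sum>t\<in>T. f (Z w) t * indicator {t} (?X w))"
      using T by (simp add: indicator_def if_distrib[of "\<lambda>c. _ * c"] cong: if_cong)
  qed
  also have "\<dots> = (\<Sum>t\<in>T. expectation (\<lambda>w. f (Z w) t * indicator {t} (?X w)))"
    by (intro Bochner_Integration.integral_sum indep_var_integrable[OF ind'] int)
  also have "\<dots> = (\<Sum>t\<in>T. expectation (\<lambda>w. f (Z w) t) * expectation (\<lambda>w. indicator {t} (?X w)))"
    by (intro sum.cong refl indep_var_lebesgue_integral[OF ind'] int)
  also have "\<dots> = (\<Sum>t\<in>T. prob {w \<in> space M. ?X w = t} * expectation (\<lambda>w. f (Z w) t))"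
  proof (intro sum.cong refl)
    fix t assume "t \<in> T"
    have ev: "{w \<in> space M. ?X w = t} \<in> events"
      using measurable_sets[OF X, of "{t}"] \<open>t \<in> T\<close> by (simp add: vimage_def Int_def conj_commute)
    have "expectation (\<lambda>w. indicat_real {t} (?X w)) = expectation (indicator {w \<in> space M. ?X w = t})"
      by (rule Bochner_Integration.integral_cong) (auto simp: indicator_def)
    then show "expectation (\<lambda>w. f (Z w) t) * expectation (\<lambda>w. indicator {t} (?X w))
        = prob {w \<in> space M. ?X w = t} * expectation (\<lambda>w. f (Z w) t)"
      using ev by (simp add: mult.commute)
  qed
  finally show ?thesis .
qed

text \<open>Adaptedness: the state after \<open>k\<close> steps is a function of the first
  \<open>k\<close> draws, so it is independent of draw \<open>k\<close>.\<close>

lemma minibatch_lsvrg_cong: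
  assumes "\<And>j. j < k \<Longrightarrow> Om j = Om' j" and "\<And>j. j < k \<Longrightarrow> s j = s' j"
  shows "minibatch_lsvrg F M R \<gamma> N x0 Om s k = minibatch_lsvrg F M R \<gamma> N x0 Om' s' k"
  using assms by (induction k) auto

text \<open>This invariant eliminates \<open>h\<close> from the state.\<close>

lemma minibatch_lsvrg_h:
  "fst (snd (minibatch_lsvrg F M R \<gamma> N x0 Om s k))
    = average M (\<lambda>m. grad (F m) (snd (snd (minibatch_lsvrg F M R \<gamma> N x0 Om s k))))"
  by (induction k) (auto simp: Let_def split: prod.splits)

lemma (in prob_space) expectation_prefix:
  fixes X :: "nat \<Rightarrow> 'a \<Rightarrow> 'b" and f :: "(nat \<Rightarrow> 'b) \<Rightarrow> 'c \<Rightarrow> real"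
  assumes ind: "indep_vars (\<lambda>_. count_space S) X UNIV" and S: "finite S"
    and g: "g \<in> S \<rightarrow> T" and T: "finite T"
  shows "expectation (\<lambda>w. f (\<lambda>i\<in>{..<k}. X i w) (g (X k w)))
    = (\<Sum>t\<in>T. prob {w \<in> space M. g (X k w) = t} * expectation (\<lambda>w. f (\<lambda>i\<in>{..<k}. X i w) t))"
proof -
  \<comment> \<open>A finite product of counting spaces on finite sets is again one, which brings
    prefixes of draws under the finite-range lemmas.\<close>
  have PiM: "PiM A (\<lambda>_. count_space S) = count_space (PiE A (\<lambda>_. S))" if "finite A" for A :: "nat set"
    using that S by (intro count_space_PiM_finite) (auto intro: countable_finite)
  have "indep_var (PiM {..<k} (\<lambda>_. count_space S)) (\<lambda>w. \<lambda>i\<in>{..<k}. X i w)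
    (PiM {k} (\<lambda>_. count_space S)) (\<lambda>w. \<lambda>i\<in>{k}. X i w)"
    using ind by (rule indep_var_restrict) auto
  then have "indep_var (count_space (PiE {..<k} (\<lambda>_. S))) (\<lambda>w. \<lambda>i\<in>{..<k}. X i w)
    (count_space (PiE {k} (\<lambda>_. S))) (\<lambda>w. \<lambda>i\<in>{k}. X i w)"
    by (simp add: PiM)
  moreover have "finite (PiE {..<k} (\<lambda>_. S))" using S by (simp add: finite_PiE)
  moreover have "(\<lambda>z. g (z k)) \<in> PiE {k} (\<lambda>_. S) \<rightarrow> T" using g by (auto simp: PiE_def Pi_def)
  ultimately have "expectation (\<lambda>w. f (\<lambda>i\<in>{..<k}. X i w) (g ((\<lambda>i\<in>{k}. X i w) k)))
      = (\<Sum>t\<in>T. prob {w \<in> space M. g ((\<lambda>i\<in>{k}. X i w) k) = t} * expectation (\<lambda>w. f (\<lambda>i\<in>{..<k}. X i w) t))"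
    using T by (rule expectation_indep_finite)
  then show ?thesis by simp
qed

lemma (in prob_space) integrable_prefix:
  fixes X :: "nat \<Rightarrow> 'a \<Rightarrow> 'b" and f :: "(nat \<Rightarrow> 'b) \<Rightarrow> real"
  assumes ind: "indep_vars (\<lambda>_. count_space S) X UNIV" and S: "finite S"
  shows "integrable M (\<lambda>w. f (\<lambda>i\<in>{..<k}. X i w))"
proof (rule integrable_finite_range[where f = f])
  have "PiM {..<k} (\<lambda>_. count_space S) = count_space (PiE {..<k} (\<lambda>_. S))"
    using S by (intro count_space_PiM_finite) (auto intro: countable_finite)
  moreover have "(\<lambda>w. \<lambda>i\<in>{..<k}. X i w) \<in> measurable M (PiM {..<k} (\<lambda>_. count_space S))"
    using ind by (intro measurable_restrict) (auto simp: indep_vars_def)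
  ultimately show "(\<lambda>w. \<lambda>i\<in>{..<k}. X i w) \<in> measurable M (count_space (PiE {..<k} (\<lambda>_. S)))"
    by simp
qed (use S in \<open>simp add: finite_PiE\<close>)

section \<open>Linear convergence\<close>

text \<open>Integrability belongs to the conclusion because the expectation of a non-integrable
  function is 0 by convention.\<close>

theorem theorem10:
  fixes F :: "nat \<Rightarrow> real ^ 'd \<Rightarrow> real" and R :: "real ^ 'd \<Rightarrow> ereal"
    and M N :: nat and L \<mu> \<gamma> p a b c \<omega>av :: real
    and x0 xstar :: "real ^ 'd"
    and P :: "'w measure" and Om :: "nat \<Rightarrow> 'w \<Rightarrow> nat set" and s :: "nat \<Rightarrow> 'w \<Rightarrow> bool"
    and x h y :: "nat \<Rightarrow> 'w \<Rightarrow> real ^ 'd"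
    and \<Psi> :: "nat \<Rightarrow> 'w \<Rightarrow> real"
  assumes "M \<ge> 1" and "L > 0" and "\<mu> > 0"
    and "\<And>m. m \<in> {1..M} \<Longrightarrow> convex_on UNIV (F m)"
    and "\<And>m. m \<in> {1..M} \<Longrightarrow> L_smooth L (F m)"
    and "strongly_convex \<mu> (\<lambda>z. average M (\<lambda>m. F m z))"
    and "proper_closed_convex R"
    and "is_arg_min (\<lambda>z. R z + ereal (average M (\<lambda>m. F m z))) (\<lambda>_. True) xstar"
    and "N \<in> {1..M}" and "0 < p" and "p \<le> 1" and "b > 1"
    and "\<omega>av = (real M - real N) / (real N * (real M - 1))"
    and "a = max (1 - (1 + b) * ((real M - real N) / (real N * (real M - 1)))) 0"
    and "0 < \<gamma>" and "\<gamma> \<le> 1 / L * (1 / (a + (1 + b)\<^sup>2 * \<omega>av))"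
    and "lsvrg_sampling P M N p Om s"
    and "\<And>k w. (x k w, h k w, y k w)
           = minibatch_lsvrg F M R \<gamma> N x0 (\<lambda>j. Om j w) (\<lambda>j. s j w) k"
    and "\<And>k w. \<Psi> k w = (norm (x k w - xstar))\<^sup>2
           + (b\<^sup>2 + b) * \<gamma>\<^sup>2 * \<omega>av * (1 / (p * real M))
             * (\<Sum>m=1..M. (norm (grad (F m) (y k w) - grad (F m) xstar))\<^sup>2)"
    and "c = 1 - min (\<gamma> * \<mu>) (p * (1 - 1 / b\<^sup>2))"
  shows "\<forall>k. integrable P (\<Psi> k) \<and>
           (\<forall>w0\<in>space P. prob_space.expectation P (\<Psi> k) \<le> c ^ k * \<Psi> 0 w0)"
proof -
  have N: "1 \<le> N" "N \<le> M" using assms(9) by auto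
  have ps: "prob_space P"
    and ind: "prob_space.indep_vars P (\<lambda>_. count_space (size_subsets M N \<times> UNIV)) (\<lambda>k w. (Om k w, s k w)) UNIV"
    and dOm: "\<And>k. distr P (count_space (size_subsets M N)) (Om k) = uniform_count_measure (size_subsets M N)"
    and ds: "\<And>k. distr P (count_space UNIV) (s k) = measure_pmf (bernoulli_pmf p)"
    using assms(17) by (auto simp: lsvrg_sampling_def)
  interpret prob_space P by (rule ps)
  let ?S = "size_subsets M N \<times> (UNIV :: bool set)"
  have fin: "finite ?S" by (simp add: finite_size_subsets)
  have mX: "(\<lambda>w. (Om k w, s k w)) \<in> measurable P (count_space ?S)" for k
    using ind by (simp add: indep_vars_def)
  have mOm: "Om k \<in> measurable P (count_space (size_subsets M N))" for k
  proof -
    have "fst \<in> measurable (count_space ?S) (count_space (size_subsets M N))" by auto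
    from measurable_compose[OF mX this] show ?thesis by simp
  qed
  have ms: "s k \<in> measurable P (count_space UNIV)" for k
    using measurable_compose[OF mX, of snd "count_space UNIV"] by simp
  have probOm: "prob {w \<in> space P. Om k w = A} = 1 / real (M choose N)" if "A \<in> size_subsets M N" for k A
  proof -
    have "prob {w \<in> space P. Om k w = A} = measure (distr P (count_space (size_subsets M N)) (Om k)) {A}"
      using that by (simp add: measure_distr[OF mOm] vimage_def Int_def conj_commute)
    then show ?thesis
      using that by (simp add: dOm measure_uniform_count_measure finite_size_subsets card_size_subsets)
  qed
  have probs: "prob {w \<in> space P. s k w = t} = (if t then p else 1 - p)" for k t
  proof -
    have "prob {w \<in> space P. s k w = t} = measure (distr P (count_space UNIV) (s k)) {t}"
      by (simp add: measure_distr[OF ms] vimage_def Int_def conj_commute)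
    then show ?thesis
      using assms(10,11) by (cases t) (simp_all add: ds measure_pmf_single)
  qed
  define V where "V z = average M (\<lambda>m. (norm (grad (F m) z - grad (F m) xstar))\<^sup>2)" for z
  define C where "C = (b\<^sup>2 + b) * \<gamma>\<^sup>2 * \<omega>av / p"
  \<comment> \<open>\<open>Z k w\<close> records the first \<open>k\<close> draws and
    \<open>st k\<close> replays the algorithm on such a record; positions from \<open>k\<close> on
    are undefined but never read.\<close>
  define Z where "Z k w = (\<lambda>i\<in>{..<k}. (Om i w, s i w))" for k w
  define st where "st k \<theta> = minibatch_lsvrg F M R \<gamma> N x0 (\<lambda>j. fst (\<theta> j)) (\<lambda>j. snd (\<theta> j)) k" for k and \<theta> :: "nat \<Rightarrow> nat set \<times> bool"
  define X where "X k \<theta> = fst (st k \<theta>)" for k \<theta>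
  define Y where "Y k \<theta> = snd (snd (st k \<theta>))" for k \<theta>
  define q where "q k \<theta> A = prox \<gamma> R (X k \<theta> - \<gamma> *\<^sub>R (average M (\<lambda>m. grad (F m) (Y k \<theta>))
      + (1 / real N) *\<^sub>R (\<Sum>m\<in>A. grad (F m) (X k \<theta>) - grad (F m) (Y k \<theta>))))" for k \<theta> A
  have st: "st k (Z k w) = (x k w, h k w, y k w)" for k w
    unfolding st_def assms(18) by (rule minibatch_lsvrg_cong) (auto simp: Z_def)
  have h: "h k w = average M (\<lambda>m. grad (F m) (y k w))" for k w
    using minibatch_lsvrg_h[of F M R \<gamma> N x0 "\<lambda>j. Om j w" "\<lambda>j. s j w" k] by (simp flip: assms(18))
  have X: "x k w = X k (Z k w)" and Y: "y k w = Y k (Z k w)" for k w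
    using st[of k w] by (simp_all add: X_def Y_def)
  have upd: "x (Suc k) w = q k (Z k w) (Om k w)" "y (Suc k) w = (if s k w then X k (Z k w) else Y k (Z k w))" for k w
    using assms(18)[of "Suc k" w] unfolding q_def X[symmetric] Y[symmetric] h[symmetric]
    by (simp_all add: Let_def flip: assms(18))
  have \<Psi>: "\<Psi> k w = (norm (x k w - xstar))\<^sup>2 + C * V (y k w)" for k w
    by (simp add: assms(19) C_def V_def average_def)
  have int: "integrable P (\<lambda>w. f (Z k w))" for f :: "_ \<Rightarrow> real" and k
    unfolding Z_def using ind fin by (rule integrable_prefix)
  have int\<Psi>: "integrable P (\<Psi> k)" for k
    unfolding \<Psi> X Y by (rule int)
  have step: "expectation (\<Psi> (Suc k)) \<le> c * expectation (\<Psi> k)" for k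
  proof -
    \<comment> \<open>The new \<open>x\<close> uses only \<open>Om k\<close> and the new
      \<open>y\<close> only \<open>s k\<close>. Each term of \<open>\<Psi>\<close> is therefore
      averaged with its own marginal law, by projecting the pair with \<open>fst\<close> or
      \<open>snd\<close>.\<close>
    have fst: "fst \<in> ?S \<rightarrow> size_subsets M N" by auto
    have Ex: "expectation (\<lambda>w. (norm (x (Suc k) w - xstar))\<^sup>2)
        = expectation (\<lambda>w. (\<Sum>A\<in>size_subsets M N. (norm (q k (Z k w) A - xstar))\<^sup>2) / real (M choose N))"
    proof -
      have "expectation (\<lambda>w. (norm (x (Suc k) w - xstar))\<^sup>2)
          = (\<Sum>A\<in>size_subsets M N. prob {w \<in> space P. Om k w = A} * expectation (\<lambda>w. (norm (q k (Z k w) A - xstar))\<^sup>2))"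
        using expectation_prefix[OF ind fin fst, of "\<lambda>\<theta> A. (norm (q k \<theta> A - xstar))\<^sup>2" k]
        by (simp add: upd Z_def finite_size_subsets)
      also have "\<dots> = (\<Sum>A\<in>size_subsets M N. expectation (\<lambda>w. (norm (q k (Z k w) A - xstar))\<^sup>2 / real (M choose N)))"
        by (simp add: probOm)
      also have "\<dots> = expectation (\<lambda>w. \<Sum>A\<in>size_subsets M N. (norm (q k (Z k w) A - xstar))\<^sup>2 / real (M choose N))"
        by (rule Bochner_Integration.integral_sum[symmetric]) (rule int)
      finally show ?thesis by (simp add: sum_divide_distrib)
    qed
    have EV: "expectation (\<lambda>w. V (y (Suc k) w)) = expectation (\<lambda>w. p * V (X k (Z k w)) + (1 - p) * V (Y k (Z k w)))"
    proof -
      have "expectation (\<lambda>w. V (y (Suc k) w))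
          = (\<Sum>t\<in>UNIV. prob {w \<in> space P. s k w = t} * expectation (\<lambda>w. V (if t then X k (Z k w) else Y k (Z k w))))"
        using expectation_prefix[OF ind fin, of snd UNIV "\<lambda>\<theta> t. V (if t then X k \<theta> else Y k \<theta>)" k]
        unfolding Z_def upd by simp
      also have "\<dots> = p * expectation (\<lambda>w. V (X k (Z k w))) + (1 - p) * expectation (\<lambda>w. V (Y k (Z k w)))"
        by (simp add: UNIV_bool probs)
      also have "\<dots> = expectation (\<lambda>w. p * V (X k (Z k w)) + (1 - p) * V (Y k (Z k w)))"
        by (subst Bochner_Integration.integral_add) (auto intro: int)
      finally show ?thesis .
    qed
    have "expectation (\<Psi> (Suc k)) = expectation (\<lambda>w. (norm (x (Suc k) w - xstar))\<^sup>2) + C * expectation (\<lambda>w. V (y (Suc k) w))"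
      unfolding \<Psi> X Y by (subst Bochner_Integration.integral_add) (auto intro: int)
    also have "\<dots> = expectation (\<lambda>w. (\<Sum>A\<in>size_subsets M N. (norm (q k (Z k w) A - xstar))\<^sup>2) / real (M choose N)
        + C * (p * V (X k (Z k w)) + (1 - p) * V (Y k (Z k w))))"
      unfolding Ex EV by (subst Bochner_Integration.integral_add) (rule int, rule int, simp)
    also have "\<dots> \<le> expectation (\<lambda>w. c * \<Psi> k w)"
      unfolding \<Psi> X Y
    proof (rule integral_mono[OF int int])
      fix w
      show "(\<Sum>A\<in>size_subsets M N. (norm (q k (Z k w) A - xstar))\<^sup>2) / real (M choose N)
          + C * (p * V (X k (Z k w)) + (1 - p) * V (Y k (Z k w)))
        \<le> c * ((norm (X k (Z k w) - xstar))\<^sup>2 + C * V (Y k (Z k w)))"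
        unfolding q_def
        by (rule lsvrg_step[OF assms(2,4-8) N assms(10,12,13) _ assms(15) _ assms(20) C_def V_def])
          (use assms(13,14,16) in auto)
    qed
    finally show ?thesis by simp
  qed
  \<comment> \<open>The minimum is at most its second argument, which is at most 1, whatever the
    size of \<open>\<gamma> * \<mu>\<close>. The induction multiplies by \<open>c\<close>.\<close>
  have "c \<ge> 0"
  proof -
    have "p * (1 - 1 / b\<^sup>2) \<le> 1 * 1"
      using assms(10-12) one_le_power[of b 2] by (intro mult_mono) auto
    then show ?thesis unfolding assms(20) by simp
  qed
  \<comment> \<open>The initial state is deterministic, so any \<open>w0\<close> represents the
    initial value.\<close>
  have init: "\<Psi> 0 w = \<Psi> 0 w'" for w w'
    using assms(18)[of 0] by (simp add: \<Psi>)
  have "expectation (\<Psi> k) \<le> c ^ k * \<Psi> 0 w0" for k w0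
  proof (induction k)
    case 0
    have "\<Psi> 0 = (\<lambda>_. \<Psi> 0 w0)" using init by blast
    then have "expectation (\<Psi> 0) = expectation (\<lambda>_. \<Psi> 0 w0)" by (rule arg_cong)
    then show ?case by (simp add: prob_space)
  next
    case (Suc k)
    have "expectation (\<Psi> (Suc k)) \<le> c * (c ^ k * \<Psi> 0 w0)"
      using step[of k] mult_left_mono[OF Suc \<open>c \<ge> 0\<close>] by linarith
    then show ?case by (simp add: mult.assoc)
  qed
  with int\<Psi> show ?thesis by blast
qed

end
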